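(* Let $G$ be a finite group such that $\frac{G}{Z(G)} \cong D_{2m}$, where $m \geq 3$. Then $$M_1(\mathcal{CCC}(G)) = \begin{cases} \frac{1}{8}\left((mx-x)(mx-x-2)^2 + 2x(x-2)^2\right), & \text{when } m \text{ is even} \\ \frac{1}{8}\left((mx-x)(mx-x-2)^2 + 8x(x-1)^2\right), & \text{when } m \text{ is odd} \end{cases}$$ and $$M_2(\mathcal{CCC}(G)) = \begin{cases} \frac{1}{32}\left((mx-x)(mx-x-2)^3 + 2x(x-2)^3\right), & \text{when } m \text{ is even} \\ \frac{1}{32}\left((mx-x)(mx-x-2)^3 + 16x(x-1)^3\right), & \text{when } m \text{ is odd,} \end{cases}$$ where $x = |Z(G)|$. Further, $\frac{M_2(\mathcal{CCC}(G))}{|e(\mathcal{CCC}(G))|} > \frac{M_1(\mathcal{CCC}(G))}{|v(\mathcal{CCC}(G))|}$.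
   Context: $Z(G)$ denotes the center of $G$, and $D_{2m} = \langle a, b : a^m = b^2 = 1, bab^{-1} = a^{-1} \rangle$ is the dihedral group of order $2m$. For a finite group $G$ and $g \in G$, $g^G$ denotes the conjugacy class of $g$ in $G$. The commuting conjugacy class graph $\mathcal{CCC}(G)$ is the simple undirected graph whose vertices are the conjugacy classes of non-central elements of $G$, where two distinct vertices $g^G$ and $h^G$ are adjacent if and only if there exist $g' \in g^G$ and $h' \in h^G$ with $g'h' = h'g'$. For a finite simple graph $\Gamma$ with vertex set $v(\Gamma)$ and edge set $e(\Gamma)$, the first and second Zagreb indices are $M_1(\Gamma) = \sum_{v \in v(\Gamma)} \deg(v)^2$ and $M_2(\Gamma) = \sum_{uv \in e(\Gamma)} \deg(u)\deg(v)$, where $\deg(v)$ is the number of edges incident to $v$.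
   Formalization: The strict inequality M_2/|e| > M_1/|v| is proved only for m ≥ 4: for m = 3 the graph is two copies of K_x, so the ratios are equal when x ≥ 2 and there are no edges when x = 1. Both index formulas are proved for all m ≥ 3. *)

theory Defs
  imports Complex_Main "HOL-Algebra.Algebra"
begin

section \<open>Dihedral groups\<close>

text \<open>The pair \<open>(i, j)\<close> stands for the normal form \<open>a\<^sup>i b\<^sup>j\<close> with \<open>0 \<le> i < m\<close> and \<open>j < 2\<close>;
  the multiplication comes from \<open>b a b\<^sup>-\<^sup>1 = a\<^sup>-\<^sup>1\<close>. The lemmas below show that this is the group
  presented by \<open>\<langle>a, b : a\<^sup>m = b\<^sup>2 = 1, b a b\<^sup>-\<^sup>1 = a\<^sup>-\<^sup>1\<rangle>\<close>.\<close>

definition dihedral_group :: "nat \<Rightarrow> (int \<times> nat) monoid" where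
  "dihedral_group m =
    \<lparr>carrier = {0..<int m} \<times> {0..<2},
     monoid.mult = (\<lambda>(i, j) (k, l). ((i + (-1) ^ j * k) mod int m, (j + l) mod 2)),
     one = (0, 0)\<rparr>"

definition dihedral_rot :: "nat \<Rightarrow> int \<times> nat" where
  "dihedral_rot m = (1 mod int m, 0)"

definition dihedral_refl :: "int \<times> nat" where
  "dihedral_refl = (0, 1)"

lemma dihedral_carrier [simp]: "carrier (dihedral_group m) = {0..<int m} \<times> {0..<2}"
  and dihedral_one [simp]: "\<one>\<^bsub>dihedral_group m\<^esub> = (0, 0)"
  and dihedral_mult [simp]: "(i, j) \<otimes>\<^bsub>dihedral_group m\<^esub> (k, l)
    = ((i + (-1) ^ j * k) mod int m, (j + l) mod 2)"
  by (simp_all add: dihedral_group_def)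

lemma less_2_nat: "j < (2::nat) \<longleftrightarrow> j = 0 \<or> j = 1"
  by auto

lemma group_dihedral_group:
  assumes "m > 0"
  shows "group (dihedral_group m)"
proof (rule groupI)
  fix x y z
  assume "x \<in> carrier (dihedral_group m)" "y \<in> carrier (dihedral_group m)"
    "z \<in> carrier (dihedral_group m)"
  then show "x \<otimes>\<^bsub>dihedral_group m\<^esub> y \<otimes>\<^bsub>dihedral_group m\<^esub> z
    = x \<otimes>\<^bsub>dihedral_group m\<^esub> (y \<otimes>\<^bsub>dihedral_group m\<^esub> z)"
    by (cases x; cases y; cases z) (auto simp: less_2_nat mod_simps algebra_simps)
next
  fix x
  assume x: "x \<in> carrier (dihedral_group m)"
  obtain i j where ij: "x = (i, j)" by (cases x)
  show "\<exists>y\<in>carrier (dihedral_group m). y \<otimes>\<^bsub>dihedral_group m\<^esub> x = \<one>\<^bsub>dihedral_group m\<^esub>"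
  proof (cases "j = 0")
    case True
    with x ij assms show ?thesis
      by (intro bexI[of _ "((- i) mod int m, 0)"]) (auto simp: mod_simps)
  next
    case False
    with x ij have "j = 1" by auto
    with x ij assms show ?thesis
      by (intro bexI[of _ x]) auto
  qed
qed (use assms in \<open>auto simp: dihedral_group_def\<close>)

lemma order_dihedral_group: "order (dihedral_group m) = 2 * m"
  by (simp add: order_def card_cartesian_product)

lemma dihedral_gens_closed:
  assumes "m > 0"
  shows "dihedral_rot m \<in> carrier (dihedral_group m)"
    and "dihedral_refl \<in> carrier (dihedral_group m)"
  using assms by (auto simp: dihedral_rot_def dihedral_refl_def)

lemma dihedral_rot_pow: "dihedral_rot m [^]\<^bsub>dihedral_group m\<^esub> (k::nat) = (int k mod int m, 0)"
  by (induction k) (auto simp: dihedral_rot_def mod_simps add.commute)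

lemma dihedral_relations:
  assumes "m > 0"
  shows "dihedral_rot m [^]\<^bsub>dihedral_group m\<^esub> m = \<one>\<^bsub>dihedral_group m\<^esub>"
    and "dihedral_refl [^]\<^bsub>dihedral_group m\<^esub> (2::nat) = \<one>\<^bsub>dihedral_group m\<^esub>"
    and "dihedral_refl \<otimes>\<^bsub>dihedral_group m\<^esub> dihedral_rot m
      \<otimes>\<^bsub>dihedral_group m\<^esub> inv\<^bsub>dihedral_group m\<^esub> dihedral_refl
      = inv\<^bsub>dihedral_group m\<^esub> dihedral_rot m"
proof -
  interpret D: group "dihedral_group m"
    by (rule group_dihedral_group[OF assms])
  note gens = dihedral_gens_closed[OF assms]
  show "dihedral_rot m [^]\<^bsub>dihedral_group m\<^esub> m = \<one>\<^bsub>dihedral_group m\<^esub>"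
    by (simp add: dihedral_rot_pow)
  show "dihedral_refl [^]\<^bsub>dihedral_group m\<^esub> (2::nat) = \<one>\<^bsub>dihedral_group m\<^esub>"
    by (simp add: numeral_2_eq_2 dihedral_refl_def)
  have refl: "inv\<^bsub>dihedral_group m\<^esub> dihedral_refl = dihedral_refl"
    by (rule D.inv_equality) (use gens in \<open>auto simp: dihedral_refl_def\<close>)
  have rot: "inv\<^bsub>dihedral_group m\<^esub> dihedral_rot m = ((- 1) mod int m, 0)"
    by (rule D.inv_equality) (use gens assms in \<open>auto simp: dihedral_rot_def mod_simps\<close>)
  show "dihedral_refl \<otimes>\<^bsub>dihedral_group m\<^esub> dihedral_rot m
      \<otimes>\<^bsub>dihedral_group m\<^esub> inv\<^bsub>dihedral_group m\<^esub> dihedral_refl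
      = inv\<^bsub>dihedral_group m\<^esub> dihedral_rot m"
    unfolding refl rot by (auto simp: dihedral_refl_def dihedral_rot_def mod_simps)
qed

lemma dihedral_normal_form:
  assumes "x \<in> carrier (dihedral_group m)"
  shows "\<exists>i j. x = dihedral_rot m [^]\<^bsub>dihedral_group m\<^esub> (i::nat)
    \<otimes>\<^bsub>dihedral_group m\<^esub> dihedral_refl [^]\<^bsub>dihedral_group m\<^esub> (j::nat)"
proof -
  obtain i j where ij: "x = (i, j)" by (cases x)
  show ?thesis
    using assms ij
    by (intro exI[of _ "nat i"] exI[of _ j])
       (auto simp: dihedral_rot_pow dihedral_refl_def less_2_nat)
qed

lemma dihedral_universal:
  assumes "group H" and m: "m > 0"
    and u: "u \<in> carrier H" and v: "v \<in> carrier H"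
    and um: "u [^]\<^bsub>H\<^esub> m = \<one>\<^bsub>H\<^esub>" and v2: "v [^]\<^bsub>H\<^esub> (2::nat) = \<one>\<^bsub>H\<^esub>"
    and vu: "v \<otimes>\<^bsub>H\<^esub> u \<otimes>\<^bsub>H\<^esub> inv\<^bsub>H\<^esub> v = inv\<^bsub>H\<^esub> u"
  shows "\<exists>\<phi> \<in> hom (dihedral_group m) H. \<phi> (dihedral_rot m) = u \<and> \<phi> dihedral_refl = v"
proof -
  interpret H: group H by fact
  define \<phi> where "\<phi> = (\<lambda>(i::int, j::nat). u [^]\<^bsub>H\<^esub> i \<otimes>\<^bsub>H\<^esub> v [^]\<^bsub>H\<^esub> j)"
  have um': "u [^]\<^bsub>H\<^esub> int m = \<one>\<^bsub>H\<^esub>"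
    using um by (simp add: int_pow_int)
  have u_mod: "u [^]\<^bsub>H\<^esub> (i mod int m) = u [^]\<^bsub>H\<^esub> i" for i :: int
  proof -
    have "u [^]\<^bsub>H\<^esub> i = u [^]\<^bsub>H\<^esub> (int m * (i div int m) + i mod int m)"
      by simp
    also have "\<dots> = (u [^]\<^bsub>H\<^esub> int m) [^]\<^bsub>H\<^esub> (i div int m) \<otimes>\<^bsub>H\<^esub> u [^]\<^bsub>H\<^esub> (i mod int m)"
      using u by (simp only: H.int_pow_mult H.int_pow_pow)
    finally show ?thesis using u um' by simp
  qed
  have vv: "v \<otimes>\<^bsub>H\<^esub> v = \<one>\<^bsub>H\<^esub>"
    using v2 v by (simp add: numeral_2_eq_2)
  have vu1: "v \<otimes>\<^bsub>H\<^esub> u = inv\<^bsub>H\<^esub> u \<otimes>\<^bsub>H\<^esub> v"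
    using vu u v by (metis H.inv_closed H.inv_solve_right H.m_closed)
  have vinv: "inv\<^bsub>H\<^esub> v = v"
    using vv v by (simp add: H.inv_equality)
  have vun: "v \<otimes>\<^bsub>H\<^esub> u [^]\<^bsub>H\<^esub> k = u [^]\<^bsub>H\<^esub> (- k) \<otimes>\<^bsub>H\<^esub> v" for k :: int
  proof -
    have nat_case: "v \<otimes>\<^bsub>H\<^esub> u [^]\<^bsub>H\<^esub> n = (inv\<^bsub>H\<^esub> u) [^]\<^bsub>H\<^esub> n \<otimes>\<^bsub>H\<^esub> v" for n :: nat
    proof (induction n)
      case (Suc n)
      have "v \<otimes>\<^bsub>H\<^esub> u [^]\<^bsub>H\<^esub> Suc n = (v \<otimes>\<^bsub>H\<^esub> u [^]\<^bsub>H\<^esub> n) \<otimes>\<^bsub>H\<^esub> u"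
        using u v by (simp add: H.m_assoc)
      also have "\<dots> = (inv\<^bsub>H\<^esub> u) [^]\<^bsub>H\<^esub> n \<otimes>\<^bsub>H\<^esub> (v \<otimes>\<^bsub>H\<^esub> u)"
        using u v by (simp add: Suc.IH H.m_assoc)
      also have "\<dots> = (inv\<^bsub>H\<^esub> u) [^]\<^bsub>H\<^esub> Suc n \<otimes>\<^bsub>H\<^esub> v"
        using u v by (simp add: vu1 H.m_assoc)
      finally show ?case .
    qed (use v in simp)
    have pos: "v \<otimes>\<^bsub>H\<^esub> u [^]\<^bsub>H\<^esub> int n = u [^]\<^bsub>H\<^esub> (- int n) \<otimes>\<^bsub>H\<^esub> v" for n :: nat
      using nat_case[of n] u by (simp add: int_pow_int H.int_pow_neg H.nat_pow_inv)
    have neg: "v \<otimes>\<^bsub>H\<^esub> u [^]\<^bsub>H\<^esub> (- int n) = u [^]\<^bsub>H\<^esub> int n \<otimes>\<^bsub>H\<^esub> v" for n :: nat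
    proof -
      have "v \<otimes>\<^bsub>H\<^esub> (v \<otimes>\<^bsub>H\<^esub> u [^]\<^bsub>H\<^esub> int n) \<otimes>\<^bsub>H\<^esub> v
        = v \<otimes>\<^bsub>H\<^esub> (u [^]\<^bsub>H\<^esub> (- int n) \<otimes>\<^bsub>H\<^esub> v) \<otimes>\<^bsub>H\<^esub> v"
        by (simp only: pos)
      moreover have "v \<otimes>\<^bsub>H\<^esub> (v \<otimes>\<^bsub>H\<^esub> u [^]\<^bsub>H\<^esub> int n) = u [^]\<^bsub>H\<^esub> int n"
        using u v vv by (simp add: H.m_assoc[symmetric])
      moreover have "v \<otimes>\<^bsub>H\<^esub> (u [^]\<^bsub>H\<^esub> (- int n) \<otimes>\<^bsub>H\<^esub> v) \<otimes>\<^bsub>H\<^esub> v = v \<otimes>\<^bsub>H\<^esub> u [^]\<^bsub>H\<^esub> (- int n)"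
        using u v vv by (simp add: H.m_assoc)
      ultimately show ?thesis by simp
    qed
    show ?thesis
      using pos neg by (cases k rule: int_cases2) auto
  qed
  have comb: "u [^]\<^bsub>H\<^esub> i \<otimes>\<^bsub>H\<^esub> v \<otimes>\<^bsub>H\<^esub> (u [^]\<^bsub>H\<^esub> k \<otimes>\<^bsub>H\<^esub> w) = u [^]\<^bsub>H\<^esub> (i - k) \<otimes>\<^bsub>H\<^esub> (v \<otimes>\<^bsub>H\<^esub> w)"
    if w: "w \<in> carrier H" for i k :: int and w
  proof -
    have "u [^]\<^bsub>H\<^esub> i \<otimes>\<^bsub>H\<^esub> v \<otimes>\<^bsub>H\<^esub> (u [^]\<^bsub>H\<^esub> k \<otimes>\<^bsub>H\<^esub> w)
      = u [^]\<^bsub>H\<^esub> i \<otimes>\<^bsub>H\<^esub> (v \<otimes>\<^bsub>H\<^esub> u [^]\<^bsub>H\<^esub> k) \<otimes>\<^bsub>H\<^esub> w"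
      using u v w by (simp add: H.m_assoc)
    also have "\<dots> = (u [^]\<^bsub>H\<^esub> i \<otimes>\<^bsub>H\<^esub> u [^]\<^bsub>H\<^esub> (- k)) \<otimes>\<^bsub>H\<^esub> (v \<otimes>\<^bsub>H\<^esub> w)"
      unfolding vun using u v w by (simp add: H.m_assoc)
    also have "\<dots> = u [^]\<^bsub>H\<^esub> (i - k) \<otimes>\<^bsub>H\<^esub> (v \<otimes>\<^bsub>H\<^esub> w)"
      using u H.int_pow_mult[OF u, of i "- k"] by simp
    finally show ?thesis .
  qed
  have "\<phi> \<in> hom (dihedral_group m) H"
  proof (rule homI)
    fix x assume "x \<in> carrier (dihedral_group m)"
    then show "\<phi> x \<in> carrier H"
      using u v by (auto simp: \<phi>_def)
  next
    fix x y
    assume x: "x \<in> carrier (dihedral_group m)" and y: "y \<in> carrier (dihedral_group m)"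
    obtain i j k l where ij: "x = (i, j)" and kl: "y = (k, l)"
      by (cases x, cases y)
    have "l = 0 \<or> l = 1" "j = 0 \<or> j = 1" using x y ij kl by auto
    then show "\<phi> (x \<otimes>\<^bsub>dihedral_group m\<^esub> y) = \<phi> x \<otimes>\<^bsub>H\<^esub> \<phi> y"
      using u v vv comb[of v i k] comb[of "\<one>\<^bsub>H\<^esub>" i k]
      by (elim disjE) (simp_all add: \<phi>_def ij kl u_mod H.m_assoc H.int_pow_mult)
  qed
  moreover have "\<phi> (dihedral_rot m) = u" "\<phi> dihedral_refl = v"
    using u v by (auto simp: \<phi>_def dihedral_rot_def dihedral_refl_def u_mod)
  ultimately show ?thesis by blast
qed


section \<open>Centre and conjugacy classes\<close>

definition group_center :: "('a, 'b) monoid_scheme \<Rightarrow> 'a set" where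
  "group_center G = {z \<in> carrier G. \<forall>g\<in>carrier G. z \<otimes>\<^bsub>G\<^esub> g = g \<otimes>\<^bsub>G\<^esub> z}"

definition conj_class :: "('a, 'b) monoid_scheme \<Rightarrow> 'a \<Rightarrow> 'a set" where
  "conj_class G g = {h \<otimes>\<^bsub>G\<^esub> g \<otimes>\<^bsub>G\<^esub> inv\<^bsub>G\<^esub> h | h. h \<in> carrier G}"


section \<open>Simple graphs and Zagreb indices\<close>

text \<open>A simple undirected graph is a pair of a vertex set and a set of edges, an edge being the
  two-element set of its ends.\<close>

type_synonym 'v sgraph = "'v set \<times> 'v set set"

definition verts :: "'v sgraph \<Rightarrow> 'v set" where
  "verts \<Gamma> = fst \<Gamma>"

definition edges :: "'v sgraph \<Rightarrow> 'v set set" where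
  "edges \<Gamma> = snd \<Gamma>"

definition vdegree :: "'v sgraph \<Rightarrow> 'v \<Rightarrow> nat" where
  "vdegree \<Gamma> v = card {e \<in> edges \<Gamma>. v \<in> e}"

definition zagreb1 :: "'v sgraph \<Rightarrow> nat" where
  "zagreb1 \<Gamma> = (\<Sum>v\<in>verts \<Gamma>. vdegree \<Gamma> v ^ 2)"

text \<open>For an edge \<open>e = {u, v}\<close> with \<open>u \<noteq> v\<close> the inner product is \<open>deg u * deg v\<close>.\<close>

definition zagreb2 :: "'v sgraph \<Rightarrow> nat" where
  "zagreb2 \<Gamma> = (\<Sum>e\<in>edges \<Gamma>. \<Prod>v\<in>e. vdegree \<Gamma> v)"


section \<open>The commuting conjugacy class graph\<close>

definition ccc_verts :: "('a, 'b) monoid_scheme \<Rightarrow> 'a set set" where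
  "ccc_verts G = conj_class G ` (carrier G - group_center G)"

definition ccc_graph :: "('a, 'b) monoid_scheme \<Rightarrow> 'a set sgraph" where
  "ccc_graph G =
    (ccc_verts G,
     {{A, B} | A B. A \<in> ccc_verts G \<and> B \<in> ccc_verts G \<and> A \<noteq> B \<and>
       (\<exists>g\<in>A. \<exists>h\<in>B. g \<otimes>\<^bsub>G\<^esub> h = h \<otimes>\<^bsub>G\<^esub> g)})"

text \<open>If \<open>G/Z(G)\<close> is dihedral of order \<open>6\<close> and \<open>x = |Z(G)|\<close>, this graph is the disjoint union of two
  complete graphs on \<open>x\<close> vertices, hence regular of degree \<open>x - 1\<close>. The ratios
  \<open>M\<^sub>2/|e|\<close> and \<open>M\<^sub>1/|v|\<close> are then equal (both \<open>(x - 1)\<^sup>2\<close>) for \<open>x \<ge> 2\<close>, and there are no edges for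
  \<open>x = 1\<close>. A strict inequality between the two ratios can therefore only be claimed for \<open>m \<noteq> 3\<close>.\<close>

end

theory Submission
  imports Defs
begin

text \<open>Let \<open>A\<close> be the preimage in \<open>G\<close> of the rotations. It is abelian, being an extension of a cyclic
  group by a central one, so a non-central element of \<open>A\<close> has centralizer \<open>A\<close> and two conjugates.
  An element \<open>g\<close> outside \<open>A\<close> commutes only with \<open>Z(G) \<union> Z(G) g\<close> and has \<open>m\<close> conjugates.
  Hence classes inside \<open>A\<close> are pairwise adjacent, and two classes outside \<open>A\<close> are adjacent iff they
  lie over the same class of reflections. The graph is therefore a disjoint union of a complete
  graph on \<open>(m - 1) x / 2\<close> vertices and of either one complete graph on \<open>x\<close> vertices (\<open>m\<close> odd)
  or two on \<open>x / 2\<close> vertices (\<open>m\<close> even).\<close>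


section \<open>Disjoint unions of complete graphs\<close>

text \<open>The cliques form an indexed family, so that each invariant becomes a sum over
  \<open>I\<close> of a function of the clique sizes alone.\<close>

locale complete_union =
  fixes \<Gamma> :: "'v sgraph" and I :: "'i set" and P :: "'i \<Rightarrow> 'v set"
  assumes finite_I: "finite I"
    and finite_P: "\<And>i. i \<in> I \<Longrightarrow> finite (P i)"
    and disjoint_P: "\<And>i j. i \<in> I \<Longrightarrow> j \<in> I \<Longrightarrow> i \<noteq> j \<Longrightarrow> P i \<inter> P j = {}"
    and verts_eq: "verts \<Gamma> = (\<Union>i\<in>I. P i)"
    and edges_eq: "edges \<Gamma> = (\<Union>i\<in>I. {e. e \<subseteq> P i \<and> card e = 2})"
begin

lemma card_verts: "card (verts \<Gamma>) = (\<Sum>i\<in>I. card (P i))"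
  unfolding verts_eq using finite_I finite_P disjoint_P by (intro card_UN_disjoint) auto

text \<open>By disjointness an edge at \<open>v\<close> stays inside \<open>P i\<close>, so the
  edges at \<open>v\<close> correspond to the other vertices \<open>w\<close> of
  \<open>P i\<close>.\<close>

lemma vdegree_eq:
  assumes i: "i \<in> I" and v: "v \<in> P i"
  shows "vdegree \<Gamma> v = card (P i) - 1"
proof -
  have "{e \<in> edges \<Gamma>. v \<in> e} = (\<lambda>w. {v, w}) ` (P i - {v})"
  proof (intro equalityI subsetI)
    fix e assume "e \<in> {e \<in> edges \<Gamma>. v \<in> e}"
    then obtain j where j: "j \<in> I" "e \<subseteq> P j" "card e = 2" "v \<in> e"
      by (auto simp: edges_eq)
    with i v disjoint_P[of i j] have "j = i" by blast
    moreover from j obtain w where "e = {v, w}" "w \<noteq> v"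
      by (auto simp: card_2_iff)
    ultimately show "e \<in> (\<lambda>w. {v, w}) ` (P i - {v})" using j by auto
  qed (use i v in \<open>auto simp: edges_eq card_2_iff\<close>)
  moreover have "inj_on (\<lambda>w. {v, w}) (P i - {v})"
    by (auto simp: inj_on_def doubleton_eq_iff)
  ultimately show ?thesis
    using v finite_P[OF i] by (simp add: vdegree_def card_image)
qed

text \<open>A common edge would lie in the empty intersection of two cliques. This permits summing
  over edges clique by clique.\<close>

lemma disjoint_edges:
  assumes "i \<in> I" "j \<in> I" "i \<noteq> j"
  shows "{e. e \<subseteq> P i \<and> card e = 2} \<inter> {e. e \<subseteq> P j \<and> card e = 2} = {}"
proof -
  have False if "e \<subseteq> P i" "e \<subseteq> P j" "card e = 2" for e
  proof -
    have "e = {}" using that disjoint_P[OF assms] by blast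
    with that show False by simp
  qed
  then show ?thesis by blast
qed

lemma card_edges: "card (edges \<Gamma>) = (\<Sum>i\<in>I. card (P i) choose 2)"
proof -
  have "card (edges \<Gamma>) = (\<Sum>i\<in>I. card {e. e \<subseteq> P i \<and> card e = 2})"
    unfolding edges_eq using finite_I finite_P disjoint_edges
    by (intro card_UN_disjoint) auto
  then show ?thesis using finite_P by (simp add: n_subsets)
qed

lemma zagreb1_eq: "zagreb1 \<Gamma> = (\<Sum>i\<in>I. card (P i) * (card (P i) - 1) ^ 2)"
proof -
  have "zagreb1 \<Gamma> = (\<Sum>i\<in>I. \<Sum>v\<in>P i. vdegree \<Gamma> v ^ 2)"
    unfolding zagreb1_def verts_eq using finite_I finite_P disjoint_P
    by (intro sum.UNION_disjoint) auto
  then show ?thesis by (simp add: vdegree_eq cong: sum.cong)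
qed

text \<open>Both ends of an edge in \<open>P i\<close> have degree \<open>card (P i) - 1\<close>, so
  all edges of one clique contribute the same product.\<close>

lemma zagreb2_eq: "zagreb2 \<Gamma> = (\<Sum>i\<in>I. (card (P i) choose 2) * (card (P i) - 1) ^ 2)"
proof -
  have "zagreb2 \<Gamma> = (\<Sum>i\<in>I. \<Sum>e | e \<subseteq> P i \<and> card e = 2. \<Prod>v\<in>e. vdegree \<Gamma> v)"
    unfolding zagreb2_def edges_eq using finite_I finite_P disjoint_edges
    by (intro sum.UNION_disjoint) auto
  also have "\<dots> = (\<Sum>i\<in>I. \<Sum>e | e \<subseteq> P i \<and> card e = 2. (card (P i) - 1) ^ 2)"
  proof (intro sum.cong refl)
    fix i e assume i: "i \<in> I" and e: "e \<in> {e. e \<subseteq> P i \<and> card e = 2}"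
    then have "(\<Prod>v\<in>e. vdegree \<Gamma> v) = (\<Prod>v\<in>e. card (P i) - 1)"
      by (intro prod.cong refl) (auto simp: vdegree_eq)
    then show "(\<Prod>v\<in>e. vdegree \<Gamma> v) = (card (P i) - 1) ^ 2" using e by simp
  qed
  finally show ?thesis using finite_P by (simp add: n_subsets)
qed

end

lemma real_choose_2: "real (n choose 2) = real n * (real n - 1) / 2"
proof (cases n)
  case (Suc k)
  \<comment> \<open>One of two consecutive numbers is even, so the division by 2 in
    \<open>choose_two\<close> is exact.\<close>
  have "even (n * (n - 1))" by (cases "even n") (auto simp: Suc)
  then have "real (n * (n - 1) div 2) = real (n * (n - 1)) / 2"
    by (simp only: real_of_nat_div)
  then show ?thesis using Suc by (simp add: choose_two algebra_simps)
qed simp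

text \<open>Truncated and real subtraction differ only at \<open>n = 0\<close>, where the factor
  \<open>n\<close> vanishes.\<close>

lemma real_mult_pred_power: "real n * real (n - 1) ^ k = real n * (real n - 1) ^ k"
  by (cases n) auto


section \<open>Conjugacy classes\<close>

context group
begin

lemma commute_mult_left:
  assumes "g \<in> carrier G" "h \<in> carrier G" "k \<in> carrier G"
    and "g \<otimes> k = k \<otimes> g" "h \<otimes> k = k \<otimes> h"
  shows "(g \<otimes> h) \<otimes> k = k \<otimes> (g \<otimes> h)"
  using assms by (metis m_assoc)

text \<open>This inverse-free form of conjugacy passes directly through a homomorphism.\<close>

lemma mem_conj_class_iff:
  assumes "g \<in> carrier G"
  shows "g' \<in> conj_class G g \<longleftrightarrow> g' \<in> carrier G \<and> (\<exists>k\<in>carrier G. k \<otimes> g = g' \<otimes> k)"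
proof
  assume "g' \<in> conj_class G g"
  then obtain k where "k \<in> carrier G" "g' = k \<otimes> g \<otimes> inv k"
    by (auto simp: conj_class_def)
  with assms show "g' \<in> carrier G \<and> (\<exists>k\<in>carrier G. k \<otimes> g = g' \<otimes> k)"
    by (intro conjI bexI[of _ k]) (auto simp: m_assoc)
next
  assume "g' \<in> carrier G \<and> (\<exists>k\<in>carrier G. k \<otimes> g = g' \<otimes> k)"
  then obtain k where "g' \<in> carrier G" "k \<in> carrier G" "k \<otimes> g = g' \<otimes> k" by auto
  with assms have "g' = k \<otimes> g \<otimes> inv k" by (simp add: m_assoc)
  with \<open>k \<in> carrier G\<close> show "g' \<in> conj_class G g" by (auto simp: conj_class_def)
qed

lemma conj_class_refl: "g \<in> carrier G \<Longrightarrow> g \<in> conj_class G g"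
  by (subst mem_conj_class_iff) auto

text \<open>Opens the way to disjointness of orbits and to the orbit-stabilizer theorem.\<close>

lemma conj_class_eq_orbit:
  assumes "g \<in> carrier G"
  shows "conj_class G g = orbit G (\<lambda>g. \<lambda>h\<in>carrier G. g \<otimes> h \<otimes> inv g) g"
  using assms by (simp add: conj_class_def orbit_def)

lemma conj_class_disjoint:
  assumes g: "g \<in> carrier G" and h: "h \<in> carrier G"
    and ne: "conj_class G g \<noteq> conj_class G h"
  shows "conj_class G g \<inter> conj_class G h = {}"
proof -
  interpret conj: group_action G "carrier G" "\<lambda>g. \<lambda>h\<in>carrier G. g \<otimes> h \<otimes> inv g"
    by (rule action_by_conjugation)
  have mem: "conj_class G k \<in> orbits G (carrier G) (\<lambda>g. \<lambda>h\<in>carrier G. g \<otimes> h \<otimes> inv g)"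
    if "k \<in> carrier G" for k
    using that by (auto simp: conj_class_eq_orbit orbits_def)
  show ?thesis
    using conj.disjoint_union[OF mem[OF g] mem[OF h]] ne by auto
qed

text \<open>Orbit-stabilizer: the stabilizer of \<open>g\<close> under conjugation is its
  centralizer.\<close>

lemma card_conj_class:
  assumes g: "g \<in> carrier G"
  shows "card (conj_class G g) * card {h \<in> carrier G. g \<otimes> h = h \<otimes> g} = order G"
proof -
  interpret conj: group_action G "carrier G" "\<lambda>g. \<lambda>h\<in>carrier G. g \<otimes> h \<otimes> inv g"
    by (rule action_by_conjugation)
  have "h \<otimes> g \<otimes> inv h = g \<longleftrightarrow> g \<otimes> h = h \<otimes> g" if "h \<in> carrier G" for h
    using g that inv_solve_right' by (metis m_closed)
  then have "stabilizer G (\<lambda>g. \<lambda>h\<in>carrier G. g \<otimes> h \<otimes> inv g) g = {h \<in> carrier G. g \<otimes> h = h \<otimes> g}"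
    using g by (auto simp: stabilizer_def)
  then show ?thesis
    using conj.orbit_stabilizer_theorem[OF g] conj_class_eq_orbit[OF g] by simp
qed

text \<open>A conjugation-invariant set is partitioned by the classes of its elements, here all of
  the same size.\<close>

lemma card_conj_classes:
  assumes fin: "finite S" and S: "S \<subseteq> carrier G"
    and inv: "\<And>g. g \<in> S \<Longrightarrow> conj_class G g \<subseteq> S"
    and card: "\<And>g. g \<in> S \<Longrightarrow> card (conj_class G g) = c"
  shows "c * card (conj_class G ` S) = card S"
proof -
  have U: "\<Union> (conj_class G ` S) = S"
    using inv S conj_class_refl by blast
  have "c * card (conj_class G ` S) = card (\<Union> (conj_class G ` S))"
  proof (rule card_partition)
    show "finite (\<Union> (conj_class G ` S))" unfolding U by (rule fin)
    fix A B assume "A \<in> conj_class G ` S" "B \<in> conj_class G ` S" "A \<noteq> B"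
    then show "A \<inter> B = {}" using conj_class_disjoint S by blast
  qed (use fin card in auto)
  then show ?thesis unfolding U .
qed

end


section \<open>Conjugacy in dihedral groups\<close>

text \<open>On reflections the label classifies conjugacy.\<close>

definition dihedral_label :: "nat \<Rightarrow> int \<times> nat \<Rightarrow> nat" where
  "dihedral_label m = (\<lambda>(i, j). if j = 0 then 0 else if even m \<and> odd i then 2 else 1)"

text \<open>For odd \<open>m\<close> all reflections are conjugate; for even \<open>m\<close> the
  parity of the rotation exponent splits them into two classes.\<close>

definition dihedral_labels :: "nat \<Rightarrow> nat set" where
  "dihedral_labels m = (if even m then {0, 1, 2} else {0, 1})"

lemma dihedral_label_mem: "dihedral_label m d \<in> dihedral_labels m"
  by (auto simp: dihedral_label_def dihedral_labels_def split: prod.splits)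

lemma dihedral_label_eq_0_iff: "dihedral_label m d = 0 \<longleftrightarrow> snd d = 0"
  by (auto simp: dihedral_label_def split: prod.splits)

text \<open>Conjugation keeps the second coordinate. On reflections it changes the rotation exponent
  by a sign and an even summand modulo \<open>m\<close>, which preserves parity when
  \<open>m\<close> is even.\<close>

lemma dihedral_label_conj:
  assumes "d \<in> carrier (dihedral_group m)" "e \<in> carrier (dihedral_group m)"
    "k \<in> carrier (dihedral_group m)"
    and eq: "k \<otimes>\<^bsub>dihedral_group m\<^esub> d = e \<otimes>\<^bsub>dihedral_group m\<^esub> k"
  shows "dihedral_label m d = dihedral_label m e"
proof -
  obtain i j i' j' a b where [simp]: "d = (i, j)" "e = (i', j')" "k = (a, b)"
    by (cases d, cases e, cases k)
  have j: "j \<in> {0, 1}" "j' \<in> {0, 1}" "b \<in> {0, 1}" using assms(1-3) by auto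
  have "(b + j) mod 2 = (j' + b) mod 2" using eq by simp
  with j have jj: "j = j'" by (auto simp: less_2_nat)
  have "even i \<longleftrightarrow> even i'" if "even m" "j = 1"
  proof -
    have "(a + (-1) ^ b * i) mod int m = (i' + (-1) ^ j * a) mod int m"
      using eq jj by simp
    then have "int m dvd (a + (-1) ^ b * i) - (i' + (-1) ^ j * a)"
      by (simp add: mod_eq_dvd_iff)
    with \<open>even m\<close> have "even ((a + (-1) ^ b * i) - (i' + (-1) ^ j * a))"
      by (metis dvd_trans even_of_nat_iff)
    then show ?thesis using j by auto
  qed
  then show ?thesis using j jj by (auto simp: dihedral_label_def)
qed

text \<open>Conjugating by the rotation with exponent \<open>c\<close> adds \<open>2 * c\<close> to
  the exponent of a reflection, so it suffices to solve a congruence for \<open>2 * c\<close> modulo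
  \<open>m\<close>.\<close>

lemma dihedral_reflections_conj:
  assumes m: "m > 0"
    and d: "d \<in> carrier (dihedral_group m)" and e: "e \<in> carrier (dihedral_group m)"
    and lab: "dihedral_label m d = dihedral_label m e" "dihedral_label m d \<noteq> 0"
  shows "\<exists>k\<in>carrier (dihedral_group m). k \<otimes>\<^bsub>dihedral_group m\<^esub> d = e \<otimes>\<^bsub>dihedral_group m\<^esub> k"
proof -
  obtain i j i' j' where [simp]: "d = (i, j)" "e = (i', j')"
    by (cases d, cases e)
  have "j \<noteq> 0" "j' \<noteq> 0" using lab by (auto simp: dihedral_label_def split: if_splits)
  with d e have [simp]: "j = 1" "j' = 1" by auto
  obtain c where c: "int m dvd 2 * c - (i' - i)"
  proof (cases "even m")
    case True
    with lab have "even (i' - i)" by (auto simp: dihedral_label_def split: if_splits)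
    then obtain c where "i' - i = 2 * c" by blast
    then show ?thesis using that[of c] by simp
  next
    case False
    then obtain k where "m = 2 * k + 1" by (auto elim: oddE)
    \<comment> \<open>The inverse of 2 modulo \<open>2 * k + 1\<close> is
      \<open>k + 1\<close>.\<close>
    then have "2 * ((i' - i) * (int k + 1)) - (i' - i) = int m * (i' - i)"
      by (simp add: algebra_simps)
    then show ?thesis using that[of "(i' - i) * (int k + 1)"] by simp
  qed
  have "(c + i) mod int m = (i' - c) mod int m"
    using c by (simp add: mod_eq_dvd_iff algebra_simps)
  then show ?thesis
    using m by (intro bexI[of _ "(c mod int m, 0)"]) (auto simp: mod_simps)
qed

lemma card_even_below: "card {i \<in> {0..<int (2 * k)}. even i} = k"
  and card_odd_below: "card {i \<in> {0..<int (2 * k)}. odd i} = k"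
proof -
  have "{i \<in> {0..<int (2 * k)}. even i} = (\<lambda>i. 2 * i) ` {0..<int k}"
    by (auto elim!: evenE)
  then show "card {i \<in> {0..<int (2 * k)}. even i} = k"
    by (simp add: card_image inj_on_def)
  have "{i \<in> {0..<int (2 * k)}. odd i} = (\<lambda>i. 2 * i + 1) ` {0..<int k}"
    by (auto elim!: oddE)
  then show "card {i \<in> {0..<int (2 * k)}. odd i} = k"
    by (simp add: card_image inj_on_def)
qed

text \<open>The identity is left out because the centre lies over it; this affects only label
  0.\<close>

lemma card_dihedral_label:
  assumes "l \<in> dihedral_labels m" and m: "m > 0"
  shows "card {d \<in> carrier (dihedral_group m). d \<noteq> (0, 0) \<and> dihedral_label m d = l}
    = (if l = 0 then m - 1 else if even m then m div 2 else m)" (is "card ?S = _")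
proof (cases "l = 0")
  case True
  then have "?S = {1..<int m} \<times> {0}"
    by (auto simp: dihedral_label_def split: if_splits)
  then show ?thesis using True m by (simp add: card_cartesian_product)
next
  case l: False
  show ?thesis
  proof (cases "even m")
    case True
    then obtain k where k: "m = 2 * k" by blast
    from assms l True have "l = 1 \<or> l = 2" by (auto simp: dihedral_labels_def)
    then show ?thesis
    proof
      assume l': "l = 1"
      have "d \<in> ?S \<longleftrightarrow> d \<in> {i \<in> {0..<int (2 * k)}. even i} \<times> {1}" for d
        unfolding l' k by (cases d) (auto simp: dihedral_label_def less_2_nat)
      then have "?S = {i \<in> {0..<int (2 * k)}. even i} \<times> {1}" by blast
      then show ?thesis using l k card_even_below by (simp only: card_cartesian_product) simp
    next
      assume l': "l = 2"
      have "d \<in> ?S \<longleftrightarrow> d \<in> {i \<in> {0..<int (2 * k)}. odd i} \<times> {1}" for d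
        unfolding l' k by (cases d) (auto simp: dihedral_label_def less_2_nat)
      then have "?S = {i \<in> {0..<int (2 * k)}. odd i} \<times> {1}" by blast
      then show ?thesis using l k card_odd_below by (simp only: card_cartesian_product) simp
    qed
  next
    case False
    with assms l have "?S = {0..<int m} \<times> {1}"
      by (auto simp: dihedral_label_def dihedral_labels_def split: if_splits)
    then show ?thesis using l False by (simp add: card_cartesian_product)
  qed
qed


section \<open>Groups with dihedral central quotient\<close>

text \<open>The isomorphism of the quotient is recast as a surjection \<open>f\<close> with kernel
  the centre, so that no cosets appear in what follows.\<close>

locale dihedral_central_quotient = group G for G (structure) +
  fixes m :: nat and f :: "'a \<Rightarrow> int \<times> nat"
  assumes finite_carrier: "finite (carrier G)"
    and m_ge_3: "m \<ge> 3"
    and f_hom: "f \<in> hom G (dihedral_group m)"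
    and f_surj: "f ` carrier G = carrier (dihedral_group m)"
    and f_kernel: "\<And>g. g \<in> carrier G \<Longrightarrow> f g = (0, 0) \<longleftrightarrow> g \<in> group_center G"
begin

sublocale f: group_hom G "dihedral_group m" f
  using group_dihedral_group[of m] m_ge_3 f_hom
  by (auto simp: group_hom_def group_hom_axioms_def)

section \<open>Centralizers of elements over rotations and over reflections\<close>

lemma snd_f: "g \<in> carrier G \<Longrightarrow> snd (f g) = 0 \<or> snd (f g) = 1"
  using f.hom_closed[of g] by (auto simp: less_2_nat)

lemma snd_f_mult:
  "g \<in> carrier G \<Longrightarrow> h \<in> carrier G \<Longrightarrow> snd (f (g \<otimes> h)) = (snd (f g) + snd (f h)) mod 2"
  by (cases "f g"; cases "f h") simp

lemma snd_f_mult_inv: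
  assumes "g \<in> carrier G" "h \<in> carrier G" "snd (f g) = snd (f h)"
  shows "snd (f (g \<otimes> inv h)) = 0"
proof -
  have "snd (f (inv h)) = snd (f h)"
    using snd_f_mult[of h "inv h"] assms snd_f[of h] snd_f[of "inv h"] f.hom_one by auto
  then show ?thesis using snd_f_mult[of g "inv h"] assms snd_f[of h] by auto
qed

lemma center_carrier: "z \<in> group_center G \<Longrightarrow> z \<in> carrier G"
  and center_commute: "z \<in> group_center G \<Longrightarrow> g \<in> carrier G \<Longrightarrow> z \<otimes> g = g \<otimes> z"
  by (auto simp: group_center_def)

lemma same_fiber_center:
  assumes g: "g \<in> carrier G" and h: "h \<in> carrier G" and fg: "f g = f h"
  shows "g \<otimes> inv h \<in> group_center G"
proof -
  have "f (g \<otimes> inv h) = (0, 0)"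
    using g h fg f.hom_inv[of h] f.H.r_inv[of "f h"] f.hom_closed[of h] by simp
  then show ?thesis using f_kernel[of "g \<otimes> inv h"] g h by (simp del: f.hom_mult)
qed

text \<open>Elements with the same image differ by a central factor and so have the same
  centralizer.\<close>

lemma same_fiber_commute:
  assumes g: "g \<in> carrier G" and h: "h \<in> carrier G" and k: "k \<in> carrier G"
    and fg: "f g = f h" and hk: "h \<otimes> k = k \<otimes> h"
  shows "g \<otimes> k = k \<otimes> g"
proof -
  have "g = (g \<otimes> inv h) \<otimes> h" using g h by (simp add: m_assoc)
  moreover have "(g \<otimes> inv h) \<otimes> k = k \<otimes> (g \<otimes> inv h)"
    using same_fiber_center[OF g h fg] k by (rule center_commute)
  ultimately show ?thesis using commute_mult_left[of "g \<otimes> inv h" h k] g h k hk by simp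
qed

text \<open>The rotations have a cyclic image, and an extension of a cyclic group by a central subgroup
  is abelian.\<close>

lemma rotations_commute:
  assumes g: "g \<in> carrier G" and h: "h \<in> carrier G"
    and sg: "snd (f g) = 0" and sh: "snd (f h) = 0"
  shows "g \<otimes> h = h \<otimes> g"
proof -
  have "dihedral_rot m \<in> f ` carrier G"
    unfolding f_surj using m_ge_3 by (intro dihedral_gens_closed) simp
  then obtain a where a: "a \<in> carrier G" "f a = dihedral_rot m" by auto
  have power: "\<exists>n::nat. f k = f (a [^] n)" if k: "k \<in> carrier G" "snd (f k) = 0" for k
  proof -
    from k f.hom_closed[of k] obtain i where i: "f k = (i, 0)" "0 \<le> i" "i < int m"
      by (cases "f k") auto
    have "f (a [^] nat i) = (int (nat i) mod int m, 0)"
      using a f.hom_nat_pow[of a "nat i"] by (simp add: dihedral_rot_pow)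
    with i show ?thesis by (intro exI[of _ "nat i"]) simp
  qed
  obtain n n' :: nat where n: "f g = f (a [^] n)" and n': "f h = f (a [^] n')"
    using power[OF g sg] power[OF h sh] by blast
  have "a [^] n \<otimes> a [^] n' = a [^] n' \<otimes> a [^] n"
    using a by (simp add: nat_pow_mult add.commute)
  \<comment> \<open>The two powers of \<open>a\<close> are exchanged for \<open>g\<close> and
    \<open>h\<close> one at a time, each within its fibre.\<close>
  then have "g \<otimes> a [^] n' = a [^] n' \<otimes> g"
    using same_fiber_commute[OF g _ _ n] a by simp
  then show ?thesis
    using same_fiber_commute[OF h _ g n'] a by simp
qed

text \<open>The rotations together with any single reflection generate \<open>G\<close>.\<close>

lemma rotation_commute_reflection_central:
  assumes g: "g \<in> carrier G" and h: "h \<in> carrier G"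
    and sg: "snd (f g) = 0" and sh: "snd (f h) = 1" and gh: "g \<otimes> h = h \<otimes> g"
  shows "g \<in> group_center G"
proof -
  have "g \<otimes> k = k \<otimes> g" if k: "k \<in> carrier G" for k
  proof (cases "snd (f k) = 0")
    case True
    then show ?thesis using rotations_commute g k sg by simp
  next
    case False
    with k sh snd_f[of k] have "snd (f (k \<otimes> inv h)) = 0"
      by (intro snd_f_mult_inv h) auto
    then have "(k \<otimes> inv h) \<otimes> g = g \<otimes> (k \<otimes> inv h)"
      using rotations_commute g h k sg by simp
    then have "((k \<otimes> inv h) \<otimes> h) \<otimes> g = g \<otimes> ((k \<otimes> inv h) \<otimes> h)"
      using commute_mult_left[of "k \<otimes> inv h" h g] g h k gh by simp
    then show ?thesis using g h k by (simp add: m_assoc)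
  qed
  then show ?thesis using g by (simp add: group_center_def)
qed

text \<open>Commuting with an element over a reflection would make \<open>g\<close> central, so the
  centralizer is the whole preimage of the rotations.\<close>

lemma commute_rotation_iff:
  assumes g: "g \<in> carrier G - group_center G" and h: "h \<in> carrier G" and sg: "snd (f g) = 0"
  shows "g \<otimes> h = h \<otimes> g \<longleftrightarrow> snd (f h) = 0"
  using rotations_commute[of g h] rotation_commute_reflection_central[of g h] snd_f[OF h] assms
  by auto

text \<open>If \<open>h\<close> commutes with \<open>g\<close>, then \<open>h\<close> or
  \<open>h \<otimes> inv g\<close> lies over a rotation and commutes with \<open>g\<close>, hence is
  central.\<close>

lemma commute_reflection_iff:
  assumes g: "g \<in> carrier G" and h: "h \<in> carrier G" and sg: "snd (f g) = 1"
  shows "g \<otimes> h = h \<otimes> g \<longleftrightarrow> f h = (0, 0) \<or> f h = f g"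
proof
  assume gh: "g \<otimes> h = h \<otimes> g"
  show "f h = (0, 0) \<or> f h = f g"
  proof (cases "snd (f h) = 0")
    case True
    then show ?thesis
      using rotation_commute_reflection_central[OF h g] f_kernel[OF h] sg gh by simp
  next
    case False
    with snd_f[OF h] sg have "snd (f (h \<otimes> inv g)) = 0"
      by (intro snd_f_mult_inv g h) auto
    moreover have "(h \<otimes> inv g) \<otimes> g = g \<otimes> (h \<otimes> inv g)"
      using g h gh by (simp add: m_assoc[symmetric]) (simp add: m_assoc)
    ultimately have "h \<otimes> inv g \<in> group_center G"
      using rotation_commute_reflection_central[of "h \<otimes> inv g" g] g h sg by simp
    then have "f (h \<otimes> inv g) = \<one>\<^bsub>dihedral_group m\<^esub>"
      using f_kernel[of "h \<otimes> inv g"] g h by simp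
    moreover have "f h = f (h \<otimes> inv g) \<otimes>\<^bsub>dihedral_group m\<^esub> f g"
      using f.hom_mult[of "h \<otimes> inv g" g] g h by (simp add: m_assoc del: f.hom_mult)
    ultimately show ?thesis using f.H.l_one[OF f.hom_closed[OF g]] by simp
  qed
next
  assume "f h = (0, 0) \<or> f h = f g"
  then show "g \<otimes> h = h \<otimes> g"
    using f_kernel[OF h] center_commute[of h g] same_fiber_commute[OF h g g] g by auto
qed

section \<open>Orders of preimages and sizes of conjugacy classes\<close>

text \<open>Each fibre of \<open>f\<close> is a coset of the centre, by right multiplication with
  one of its elements.\<close>

lemma card_preimage:
  assumes S: "S \<subseteq> carrier (dihedral_group m)"
  shows "card {g \<in> carrier G. f g \<in> S} = card S * card (group_center G)"
proof -
  have fiber: "card {g \<in> carrier G. f g = d} = card (group_center G)" if "d \<in> S" for d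
  proof -
    have "d \<in> f ` carrier G" unfolding f_surj using that S by (rule set_mp[rotated])
    then obtain g where g: "g \<in> carrier G" "f g = d" by (metis imageE)
    have "bij_betw (\<lambda>z. z \<otimes> g) (group_center G) {h \<in> carrier G. f h = d}"
    proof (rule bij_betwI[where g = "\<lambda>h. h \<otimes> inv g"])
      show "(\<lambda>z. z \<otimes> g) \<in> group_center G \<rightarrow> {h \<in> carrier G. f h = d}"
      proof
        fix z assume z: "z \<in> group_center G"
        then have "f z = \<one>\<^bsub>dihedral_group m\<^esub>" using f_kernel center_carrier by simp
        then show "z \<otimes> g \<in> {h \<in> carrier G. f h = d}"
          using z g center_carrier f.H.l_one[OF f.hom_closed[OF g(1)]] by simp
      qed
      show "(\<lambda>h. h \<otimes> inv g) \<in> {h \<in> carrier G. f h = d} \<rightarrow> group_center G"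
        using same_fiber_center g by auto
    qed (use g center_carrier in \<open>auto simp: m_assoc\<close>)
    then show ?thesis by (simp add: bij_betw_same_card)
  qed
  have "finite S" using S finite_carrier f_surj by (metis finite_imageI finite_subset)
  have "{g \<in> carrier G. f g \<in> S} = (\<Union>d\<in>S. {g \<in> carrier G. f g = d})" by auto
  also have "card \<dots> = (\<Sum>d\<in>S. card {g \<in> carrier G. f g = d})"
    using \<open>finite S\<close> finite_carrier by (intro card_UN_disjoint) auto
  finally show ?thesis using fiber by simp
qed

lemma card_center_pos: "card (group_center G) > 0"
proof -
  have "\<one> \<in> group_center G" by (simp add: group_center_def)
  moreover have "finite (group_center G)"
    using finite_carrier by (rule rev_finite_subset) (auto simp: group_center_def)
  ultimately show ?thesis by (auto simp: card_gt_0_iff)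
qed

lemma order_eq: "order G = 2 * m * card (group_center G)"
proof -
  have "{g \<in> carrier G. f g \<in> carrier (dihedral_group m)} = carrier G"
    using f.hom_closed by blast
  then show ?thesis
    using card_preimage[of "carrier (dihedral_group m)"] order_dihedral_group[of m]
    by (simp add: order_def)
qed

text \<open>In a group of order \<open>2 * m * x\<close>, with \<open>x\<close> the order of the
  centre, the centralizers consist of \<open>m\<close> fibres over a rotation and of 2 fibres over a
  reflection.\<close>

lemma card_conj_class_noncentral:
  assumes g: "g \<in> carrier G - group_center G"
  shows "card (conj_class G g) = (if snd (f g) = 0 then 2 else m)"
proof -
  let ?C = "{h \<in> carrier G. g \<otimes> h = h \<otimes> g}"
  have *: "card (conj_class G g) * card ?C = 2 * m * card (group_center G)"
    using card_conj_class[of g] g order_eq by simp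
  show ?thesis
  proof (cases "snd (f g) = 0")
    case True
    have "?C = {h \<in> carrier G. f h \<in> {0..<int m} \<times> {0}}"
    proof -
      have "snd (f h) = 0 \<longleftrightarrow> f h \<in> {0..<int m} \<times> {0}" if "h \<in> carrier G" for h
        using f.hom_closed[OF that] by (cases "f h") auto
      then show ?thesis using commute_rotation_iff[OF g _ True] by auto
    qed
    then have "card ?C = m * card (group_center G)"
      by (simp only: card_preimage) (subst card_preimage, auto simp: card_cartesian_product)
    with * True m_ge_3 card_center_pos show ?thesis by simp
  next
    case False
    with snd_f[of g] g have sg: "snd (f g) = 1" by auto
    have "?C = {h \<in> carrier G. f h \<in> {(0, 0), f g}}"
      using commute_reflection_iff[of g] g sg by auto
    moreover have "card {(0, 0), f g} = 2" using sg by (cases "f g") auto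
    moreover have "{(0, 0), f g} \<subseteq> carrier (dihedral_group m)"
      using f.hom_closed[of g] g m_ge_3 by auto
    ultimately have "card ?C = 2 * card (group_center G)"
      by (simp only: card_preimage)
    with * False card_center_pos show ?thesis by simp
  qed
qed

section \<open>Labels and adjacency of conjugacy classes\<close>

definition label :: "'a \<Rightarrow> nat" where
  "label g = dihedral_label m (f g)"

definition label_set :: "nat \<Rightarrow> 'a set" where
  "label_set l = {g \<in> carrier G - group_center G. label g = l}"

text \<open>Conjugacy is carried by \<open>f\<close> to the dihedral group, where labels are
  invariant; a central conjugate of \<open>g\<close> would be \<open>g\<close> itself.\<close>

lemma label_set_conj:
  assumes g: "g \<in> label_set l"
  shows "conj_class G g \<subseteq> label_set l"
proof
  fix g' assume "g' \<in> conj_class G g"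
  with g obtain k where k: "g' \<in> carrier G" "k \<in> carrier G" "k \<otimes> g = g' \<otimes> k"
    by (auto simp: mem_conj_class_iff label_set_def)
  from g have gc: "g \<in> carrier G" "g \<notin> group_center G" "label g = l"
    by (auto simp: label_set_def)
  have "g' \<notin> group_center G"
  proof
    assume "g' \<in> group_center G"
    then have "k \<otimes> g = k \<otimes> g'" using k center_commute by simp
    then have "g = g'" using k gc by simp
    with gc \<open>g' \<in> group_center G\<close> show False by simp
  qed
  moreover have "f k \<otimes>\<^bsub>dihedral_group m\<^esub> f g = f g' \<otimes>\<^bsub>dihedral_group m\<^esub> f k"
    using k gc by (metis f.hom_mult)
  then have "label g = label g'"
    unfolding label_def by (rule dihedral_label_conj[rotated 3]) (use k gc f.hom_closed in blast)+
  ultimately show "g' \<in> label_set l" using k gc by (simp add: label_set_def)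
qed

text \<open>Commuting non-central elements lie both over rotations or over one reflection.
  Conversely, for reflections with equal labels \<open>g\<close> has a conjugate in the fibre of
  \<open>h\<close>.\<close>

lemma commuting_classes_iff:
  assumes g: "g \<in> carrier G - group_center G" and h: "h \<in> carrier G - group_center G"
  shows "(\<exists>g'\<in>conj_class G g. \<exists>h'\<in>conj_class G h. g' \<otimes> h' = h' \<otimes> g') \<longleftrightarrow> label g = label h"
proof
  assume "\<exists>g'\<in>conj_class G g. \<exists>h'\<in>conj_class G h. g' \<otimes> h' = h' \<otimes> g'"
  then obtain g' h' where "g' \<in> conj_class G g" "h' \<in> conj_class G h"
    and comm: "g' \<otimes> h' = h' \<otimes> g'" by auto
  with label_set_conj[of g "label g"] label_set_conj[of h "label h"] g h
  have g': "g' \<in> carrier G - group_center G" "label g' = label g"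
    and h': "h' \<in> carrier G - group_center G" "label h' = label h"
    by (auto simp: label_set_def)
  have "label g' = label h'"
  proof (cases "snd (f g') = 0")
    case True
    then have "snd (f h') = 0" using commute_rotation_iff[of g' h'] g' h' comm by simp
    with True show ?thesis
      using dihedral_label_eq_0_iff[of m "f g'"] dihedral_label_eq_0_iff[of m "f h'"]
      by (simp add: label_def)
  next
    case False
    with snd_f[of g'] g' have "snd (f g') = 1" by auto
    then have "f h' = f g'"
      using commute_reflection_iff[of g' h'] f_kernel[of h'] g' h' comm by auto
    then show ?thesis by (simp add: label_def)
  qed
  with g' h' show "label g = label h" by simp
next
  assume lab: "label g = label h"
  show "\<exists>g'\<in>conj_class G g. \<exists>h'\<in>conj_class G h. g' \<otimes> h' = h' \<otimes> g'"
  proof (cases "label g = 0")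
    case True
    with lab have "snd (f g) = 0" "snd (f h) = 0"
      using dihedral_label_eq_0_iff[of m "f g"] dihedral_label_eq_0_iff[of m "f h"]
      by (simp_all add: label_def)
    then have "g \<otimes> h = h \<otimes> g" using rotations_commute g h by simp
    then show ?thesis using conj_class_refl g h by blast
  next
    case False
    obtain d where d: "d \<in> carrier (dihedral_group m)"
      "d \<otimes>\<^bsub>dihedral_group m\<^esub> f g = f h \<otimes>\<^bsub>dihedral_group m\<^esub> d"
      using dihedral_reflections_conj[of m "f g" "f h"] m_ge_3 g h lab False f.hom_closed
      unfolding label_def by (metis DiffD1 gr0I not_numeral_le_zero)
    \<comment> \<open>A lift of the conjugating element \<open>d\<close> moves \<open>g\<close> into
      the fibre of \<open>h\<close>, all of which commutes with \<open>h\<close>.\<close>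
    with f_surj obtain k where k: "k \<in> carrier G" "f k = d" by (metis imageE)
    define g' where "g' = k \<otimes> g \<otimes> inv k"
    have g': "g' \<in> carrier G" "g' \<in> conj_class G g"
      using g k by (auto simp: g'_def conj_class_def)
    have "g' \<otimes> k = k \<otimes> g" using g k by (simp add: g'_def m_assoc)
    then have "f g' \<otimes>\<^bsub>dihedral_group m\<^esub> d = f h \<otimes>\<^bsub>dihedral_group m\<^esub> d"
      using d k g g' by (metis DiffD1 f.hom_mult)
    then have "f g' = f h"
      using f.H.right_cancel[OF d(1) f.hom_closed[OF g'(1)] f.hom_closed[of h]] h by blast
    then have "g' \<otimes> h = h \<otimes> g'" using same_fiber_commute[of g' h h] g' h by simp
    then show ?thesis using conj_class_refl g' h by blast
  qed
qed

section \<open>Decomposition of the graph into cliques and their sizes\<close>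

definition part :: "nat \<Rightarrow> 'a set set" where
  "part l = conj_class G ` label_set l"

text \<open>Adjacency of distinct classes is equality of labels, so the classes with one label form
  a clique and no edge joins two labels.\<close>

lemma complete_union_ccc_graph: "complete_union (ccc_graph G) (dihedral_labels m) part"
proof
  show "finite (dihedral_labels m)" by (simp add: dihedral_labels_def)
  show "finite (part l)" for l
    using finite_carrier by (auto simp: part_def label_set_def)
  \<comment> \<open>A class determines its label because label sets are closed under conjugation;
    this makes the parts disjoint.\<close>
  have part_label: "l = label g"
    if "g \<in> carrier G - group_center G" "conj_class G g \<in> part l" for g l
  proof -
    from that obtain h where h: "h \<in> label_set l" "conj_class G g = conj_class G h"
      by (auto simp: part_def)
    then have "g \<in> label_set l"
      using label_set_conj[of h l] conj_class_refl[of g] that by auto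
    then show ?thesis by (simp add: label_set_def)
  qed
  show "part i \<inter> part j = {}" if "i \<noteq> j" for i j
  proof -
    have "i = j" if "A \<in> part i" "A \<in> part j" for A
    proof -
      from that(1) obtain g where "g \<in> carrier G - group_center G" "A = conj_class G g"
        by (auto simp: part_def label_set_def)
      with part_label[of g i] part_label[of g j] that show ?thesis by simp
    qed
    with that show ?thesis by blast
  qed
  have label_part: "conj_class G g \<in> part (label g)" if "g \<in> carrier G - group_center G" for g
    using that by (auto simp: part_def label_set_def)
  have label_mem: "label g \<in> dihedral_labels m" for g
    by (simp add: label_def dihedral_label_mem)
  show "verts (ccc_graph G) = (\<Union>l\<in>dihedral_labels m. part l)"
    using label_part label_mem
    by (fastforce simp: verts_def ccc_graph_def ccc_verts_def part_def label_set_def)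
  show "edges (ccc_graph G) = (\<Union>l\<in>dihedral_labels m. {e. e \<subseteq> part l \<and> card e = 2})"
  proof (intro equalityI subsetI)
    fix e assume "e \<in> edges (ccc_graph G)"
    then obtain g h where gh: "g \<in> carrier G - group_center G" "h \<in> carrier G - group_center G"
      "e = {conj_class G g, conj_class G h}" "conj_class G g \<noteq> conj_class G h"
      "\<exists>g'\<in>conj_class G g. \<exists>h'\<in>conj_class G h. g' \<otimes> h' = h' \<otimes> g'"
      by (auto simp: edges_def ccc_graph_def ccc_verts_def)
    then have "label g = label h" using commuting_classes_iff by blast
    then have "e \<subseteq> part (label g) \<and> card e = 2"
      using gh label_part[of g] label_part[of h] by simp
    then show "e \<in> (\<Union>l\<in>dihedral_labels m. {e. e \<subseteq> part l \<and> card e = 2})"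
      using label_mem by blast
  next
    fix e assume "e \<in> (\<Union>l\<in>dihedral_labels m. {e. e \<subseteq> part l \<and> card e = 2})"
    then obtain l A B where e: "e = {A, B}" "A \<noteq> B" "A \<in> part l" "B \<in> part l"
      by (auto simp: card_2_iff)
    then obtain g h where gh: "g \<in> label_set l" "h \<in> label_set l" "A = conj_class G g"
      "B = conj_class G h" by (auto simp: part_def)
    then have "g \<in> carrier G - group_center G" "h \<in> carrier G - group_center G"
      "label g = label h" by (auto simp: label_set_def)
    moreover from this have "\<exists>g'\<in>A. \<exists>h'\<in>B. g' \<otimes> h' = h' \<otimes> g'"
      using commuting_classes_iff gh by blast
    ultimately show "e \<in> edges (ccc_graph G)"
      using e gh by (auto simp: edges_def ccc_graph_def ccc_verts_def)
  qed
qed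

text \<open>The size of the label set is divided by the common class size, 2 for label 0 and
  \<open>m\<close> otherwise.\<close>

lemma card_part:
  assumes l: "l \<in> dihedral_labels m"
  shows "real (card (part l)) = (if l = 0 then (real m - 1) * real (card (group_center G)) / 2
    else if even m then real (card (group_center G)) / 2 else real (card (group_center G)))"
proof -
  let ?x = "card (group_center G)"
  let ?S = "{d \<in> carrier (dihedral_group m). d \<noteq> (0, 0) \<and> dihedral_label m d = l}"
  \<comment> \<open>Leaving out the centre amounts to leaving out the fibre over
    \<open>(0, 0)\<close>.\<close>
  have "label_set l = {g \<in> carrier G. f g \<in> ?S}"
    using f_kernel f.hom_closed by (auto simp: label_set_def label_def)
  moreover have "card {g \<in> carrier G. f g \<in> ?S} = card ?S * ?x"
    by (rule card_preimage) blast
  ultimately have S: "card (label_set l) = card ?S * ?x" by simp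
  have "(if l = 0 then 2 else m) * card (part l) = card (label_set l)"
    unfolding part_def
  proof (rule card_conj_classes)
    fix g assume "g \<in> label_set l"
    then show "card (conj_class G g) = (if l = 0 then 2 else m)"
      using card_conj_class_noncentral[of g] dihedral_label_eq_0_iff[of m "f g"]
      by (auto simp: label_set_def label_def)
  qed (use finite_carrier label_set_conj in \<open>auto simp: label_set_def\<close>)
  with S card_dihedral_label[OF l] m_ge_3
  have "(if l = 0 then 2 else m) * card (part l)
    = (if l = 0 then m - 1 else if even m then m div 2 else m) * ?x"
    by simp
  then have eq: "real (if l = 0 then 2 else m) * real (card (part l))
    = real (if l = 0 then m - 1 else if even m then m div 2 else m) * real ?x"
    by (metis of_nat_mult)
  show ?thesis
  proof (cases "l = 0")
    case True
    with eq m_ge_3 show ?thesis by (simp add: of_nat_diff)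
  next
    case False
    have "real (m div 2) = real m / 2" if "even m" using that by (simp add: real_of_nat_div)
    with False eq have "real m * real (card (part l))
      = real m * (if even m then real ?x / 2 else real ?x)"
      by auto
    with False m_ge_3 show ?thesis by simp
  qed
qed

end

section \<open>From the isomorphism of the quotient to the final formulas\<close>

text \<open>The map is the projection to cosets followed by the isomorphism, whose injectivity makes
  the centre its kernel.\<close>

lemma dihedral_central_quotient_exists:
  fixes G (structure)
  assumes "group G" and fin: "finite (carrier G)" and m: "m \<ge> 3"
    and iso: "G Mod (group_center G) \<cong> dihedral_group m"
  shows "\<exists>f. dihedral_central_quotient G m f"
proof -
  interpret group G by fact
  let ?Z = "group_center G"
  have sub: "subgroup ?Z G"
  proof (rule subgroupI)
    fix a assume "a \<in> ?Z"
    then show "inv a \<in> ?Z"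
      by (auto simp: group_center_def) (metis inv_closed inv_mult_group inv_inv)
  next
    fix a b assume a: "a \<in> ?Z" and b: "b \<in> ?Z"
    have "a \<otimes> b \<otimes> k = k \<otimes> (a \<otimes> b)" if "k \<in> carrier G" for k
      using a b that by (intro commute_mult_left) (auto simp: group_center_def)
    moreover have "a \<otimes> b \<in> carrier G"
      using a b unfolding group_center_def by blast
    ultimately show "a \<otimes> b \<in> ?Z" unfolding group_center_def by blast
  qed (auto simp: group_center_def)
  interpret Z: normal ?Z G
  proof (rule normal_invI[OF sub])
    fix g z assume g: "g \<in> carrier G" and z: "z \<in> ?Z"
    then have "z \<in> carrier G" "g \<otimes> z = z \<otimes> g"
      unfolding group_center_def by auto
    then have "g \<otimes> z \<otimes> inv g = z" using g by (simp add: m_assoc)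
    with z show "g \<otimes> z \<otimes> inv g \<in> ?Z" by simp
  qed
  interpret Q: group "G Mod ?Z" by (rule Z.factorgroup_is_group)
  obtain \<phi> where \<phi>: "\<phi> \<in> iso (G Mod ?Z) (dihedral_group m)"
    using iso by (auto simp: is_iso_def)
  interpret D: group "dihedral_group m" using group_dihedral_group m by simp
  have \<phi>_hom: "\<phi> \<in> hom (G Mod ?Z) (dihedral_group m)"
    and bij: "bij_betw \<phi> (carrier (G Mod ?Z)) (carrier (dihedral_group m))"
    using \<phi> by (auto simp: iso_def)
  have carrier_Mod: "carrier (G Mod ?Z) = (\<lambda>g. ?Z #> g) ` carrier G"
    by (auto simp: FactGroup_def RCOSETS_def)
  have hom: "(\<lambda>g. \<phi> (?Z #> g)) \<in> hom G (dihedral_group m)"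
    using Group.hom_compose[OF Z.r_coset_hom_Mod \<phi>_hom] by (simp add: comp_def)
  have surj: "(\<lambda>g. \<phi> (?Z #> g)) ` carrier G = carrier (dihedral_group m)"
    using bij by (simp add: bij_betw_def carrier_Mod image_image)
  have ker: "\<phi> (?Z #> g) = (0, 0) \<longleftrightarrow> g \<in> ?Z" if g: "g \<in> carrier G" for g
  proof -
    have "\<phi> ?Z = (0, 0)"
      using hom_one[OF \<phi>_hom Q.is_group D.is_group] by simp
    moreover have "\<phi> (?Z #> g) = \<phi> ?Z \<longleftrightarrow> ?Z #> g = ?Z"
      using bij g Q.one_closed by (intro inj_on_eq_iff[of \<phi>]) (auto simp: bij_betw_def carrier_Mod)
    moreover have "?Z #> g = ?Z \<longleftrightarrow> g \<in> ?Z"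
      using g sub coset_join1 coset_join2 by blast
    ultimately show ?thesis by simp
  qed
  show ?thesis
    by (rule exI[of _ "\<lambda>g. \<phi> (?Z #> g)"]) (unfold_locales; fact fin m hom surj ker)
qed

text \<open>Chebyshev's inequality for the degrees of a vertex set of \<open>n\<close> vertices of degree \<open>n - 1\<close> and
  \<open>w * k\<close> vertices of degree \<open>k - 1\<close>: the difference of the cross products is
  \<open>n * w * k * (n - k)\<^sup>2 * (n + k - 2) / 2\<close>.\<close>

lemma complete_union_ratio_less:
  fixes n k w :: real
  assumes "w > 0" "k \<ge> 1" "n > k"
  shows "(n * (n - 1) ^ 2 + w * (k * (k - 1) ^ 2)) / (n + w * k)
    < (n * (n - 1) / 2 * (n - 1) ^ 2 + w * (k * (k - 1) / 2 * (k - 1) ^ 2))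
      / (n * (n - 1) / 2 + w * (k * (k - 1) / 2))"
proof -
  have "0 < n * (w * k) * (n - k) ^ 2 * (n + k - 2) / 2"
    using assms by (intro divide_pos_pos mult_pos_pos) auto
  also have "\<dots> = (n * (n - 1) / 2 * (n - 1) ^ 2 + w * (k * (k - 1) / 2 * (k - 1) ^ 2)) * (n + w * k)
    - (n * (n - 1) ^ 2 + w * (k * (k - 1) ^ 2)) * (n * (n - 1) / 2 + w * (k * (k - 1) / 2))"
    by (simp add: field_simps power2_eq_square)
  finally have "(n * (n - 1) ^ 2 + w * (k * (k - 1) ^ 2)) * (n * (n - 1) / 2 + w * (k * (k - 1) / 2))
    < (n * (n - 1) / 2 * (n - 1) ^ 2 + w * (k * (k - 1) / 2 * (k - 1) ^ 2)) * (n + w * k)"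
    by simp
  moreover have "n + w * k > 0" using assms by (intro add_pos_pos mult_pos_pos) auto
  \<comment> \<open>Since \<open>n > 1\<close>, the larger clique has edges, so the edge count is
    positive even if \<open>k = 1\<close>.\<close>
  moreover have "n * (n - 1) / 2 + w * (k * (k - 1) / 2) > 0"
    using assms by (intro add_pos_nonneg mult_nonneg_nonneg divide_pos_pos mult_pos_pos) auto
  ultimately show ?thesis by (simp add: divide_less_eq less_divide_eq)
qed

theorem theorem2p8:
  fixes G (structure) and m :: nat and x :: real
  assumes "group G" and "finite (carrier G)"
    and "m \<ge> 3"
    and "G Mod (group_center G) \<cong> dihedral_group m"
    and "x = real (card (group_center G))"
  shows "(real (zagreb1 (ccc_graph G)) =
      (if even m
       then 1 / 8 * ((real m * x - x) * (real m * x - x - 2) ^ 2 + 2 * x * (x - 2) ^ 2)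
       else 1 / 8 * ((real m * x - x) * (real m * x - x - 2) ^ 2 + 8 * x * (x - 1) ^ 2)))
    \<and> (real (zagreb2 (ccc_graph G)) =
      (if even m
       then 1 / 32 * ((real m * x - x) * (real m * x - x - 2) ^ 3 + 2 * x * (x - 2) ^ 3)
       else 1 / 32 * ((real m * x - x) * (real m * x - x - 2) ^ 3 + 16 * x * (x - 1) ^ 3)))
    \<and> (m \<noteq> 3 \<longrightarrow>
      real (zagreb2 (ccc_graph G)) / real (card (edges (ccc_graph G)))
      > real (zagreb1 (ccc_graph G)) / real (card (verts (ccc_graph G))))"
proof -
  obtain f where "dihedral_central_quotient G m f"
    using dihedral_central_quotient_exists assms(1-4) by blast
  then interpret dihedral_central_quotient G m f .
  interpret complete_union "ccc_graph G" "dihedral_labels m" part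
    by (rule complete_union_ccc_graph)
  \<comment> \<open>\<open>n\<close> is the size of the clique over rotations, and \<open>k\<close>
    the common size of the \<open>w\<close> cliques over reflections.\<close>
  define n where "n = real (card (part 0))"
  define k where "k = real (card (part 1))"
  define w :: real where "w = (if even m then 2 else 1)"
  have n: "n = (real m - 1) * x / 2"
    using card_part[of 0] assms(5) by (simp add: n_def dihedral_labels_def)
  have k: "k = (if even m then x / 2 else x)"
    using card_part[of 1] assms(5) by (simp add: k_def dihedral_labels_def)
  have "real (card (part 2)) = k" if "even m"
    using card_part[of 2] assms(5) that k by (simp add: dihedral_labels_def)
  \<comment> \<open>Each of the four invariants is an instance of this sum for a suitable
    \<open>F\<close>.\<close>
  then have sum: "(\<Sum>l\<in>dihedral_labels m. F (real (card (part l)))) = F n + w * F k"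
    for F :: "real \<Rightarrow> real"
    by (simp add: dihedral_labels_def n_def k_def w_def)
  have M1: "real (zagreb1 (ccc_graph G)) = n * (n - 1) ^ 2 + w * (k * (k - 1) ^ 2)"
    using sum[of "\<lambda>n. n * (n - 1) ^ 2"] by (simp add: zagreb1_eq real_mult_pred_power del: One_nat_def)
  have pred: "real (n choose 2) * real (n - 1) ^ 2 = real n * (real n - 1) / 2 * (real n - 1) ^ 2" for n
    by (cases n) (simp_all add: real_choose_2)
  have M2: "real (zagreb2 (ccc_graph G))
    = n * (n - 1) / 2 * (n - 1) ^ 2 + w * (k * (k - 1) / 2 * (k - 1) ^ 2)"
    using sum[of "\<lambda>n. n * (n - 1) / 2 * (n - 1) ^ 2"] by (simp add: zagreb2_eq pred del: One_nat_def)
  have E: "real (card (edges (ccc_graph G))) = n * (n - 1) / 2 + w * (k * (k - 1) / 2)"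
    using sum[of "\<lambda>n. n * (n - 1) / 2"] by (simp add: card_edges real_choose_2)
  have V: "real (card (verts (ccc_graph G))) = n + w * k"
    using sum[of "\<lambda>n. n"] by (simp add: card_verts)
  have x: "x > 0" using card_center_pos assms(5) by simp
  have "real (zagreb1 (ccc_graph G)) / real (card (verts (ccc_graph G)))
    < real (zagreb2 (ccc_graph G)) / real (card (edges (ccc_graph G)))" if "m \<noteq> 3"
    unfolding M1 M2 E V
  proof (rule complete_union_ratio_less)
    show "w > 0" by (simp add: w_def)
    \<comment> \<open>Being the cardinality of a part, \<open>k\<close> is a natural number, so
      positivity already gives \<open>k \<ge> 1\<close>.\<close>
    have "k > 0" using x k by simp
    then show "k \<ge> 1" by (simp add: k_def)
    \<comment> \<open>For even \<open>m\<close> this amounts to \<open>m - 1 > 1\<close>, for odd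
      \<open>m\<close> to \<open>m - 1 > 2\<close>; the latter is where \<open>m \<noteq> 3\<close>
      enters.\<close>
    show "n > k"
    proof (cases "even m")
      case True
      have "(real m - 1) * x > 1 * x" using x assms(3) by (intro mult_strict_right_mono) auto
      then show ?thesis using n k True by simp
    next
      case False
      with that assms(3) have "m > 3" by simp
      then have "(real m - 1) * x > 2 * x" using x by (intro mult_strict_right_mono) auto
      then show ?thesis using n k False by simp
    qed
  qed
  then show ?thesis
    unfolding M1 M2 n k w_def
    by (auto simp: field_simps power2_eq_square power3_eq_cube)
qed

end
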